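(* Let $p$ be a prime. There exist sequences of nonnegative integers $(q_n)_{n\ge1}$, $(r_n)_{n\ge1}$, $(s_n)_{n\ge1}$ such that for every $n\ge1$ the $p\times p$ matrix $m_{np}^{p,p}=(m_{np}^{p,p}(i,j))_{0\le i,j\le p-1}$ (rows and columns indexed in the order $0,1,\dots,p-1$) equals $$\begin{bmatrix}q_nJ_{1,1} & r_nJ_{1,p-1}\\ r_nJ_{p-1,1} & s_nJ_{p-1,p-1}\end{bmatrix}.$$ Likewise, there exist three sequences of nonnegative integers giving the same block decomposition for the matrices $m_{np+1}^{p,p}$, $n\ge1$.
   Context: $S_n$ is the symmetric group on $[n]$. For $\pi=a_1\cdots a_n\in S_n$, $\mathrm{maj}\,\pi=\sum_{a_i>a_{i+1}} i$. For positive integers $k,l$ and nonnegative integers $i,j$, $m_n^{k,l}(i,j)=\#\{\pi\in S_n:\ \mathrm{maj}\,\pi\equiv i \pmod k,\ \mathrm{maj}\,\pi^{-1}\equiv j\pmod l\}$. $J_{a,b}$ denotes the $a\times b$ all-ones matrix. *)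

theory Defs
  imports
    "HOL-Combinatorics.Permutations"
    "HOL-Number_Theory.Cong"
    "HOL-Computational_Algebra.Primes"
    "Jordan_Normal_Form.Matrix"
begin

text \<open>
  An element of \<open>S\<^sub>n\<close> is a function on all of \<open>nat\<close> that permutes \<open>{1..n}\<close> and fixes
  everything else, so the function inverse is the group inverse. The name
  \<open>Hilbert_Choice.inv\<close> is qualified because plain \<open>inv\<close> is the group inverse notation
  of HOL-Algebra here.
\<close>

definition sym_group :: "nat \<Rightarrow> (nat \<Rightarrow> nat) set" where
  "sym_group n = {\<pi>. \<pi> permutes {1..n}}"

definition maj :: "nat \<Rightarrow> (nat \<Rightarrow> nat) \<Rightarrow> nat" where
  "maj n \<pi> = (\<Sum>i | i \<in> {1..<n} \<and> \<pi> i > \<pi> (i + 1). i)"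

definition maj_count :: "nat \<Rightarrow> nat \<Rightarrow> nat \<Rightarrow> nat \<Rightarrow> nat \<Rightarrow> nat" where
  "maj_count n k l i j =
     card {\<pi> \<in> sym_group n. [maj n \<pi> = i] (mod k) \<and> [maj n (Hilbert_Choice.inv \<pi>) = j] (mod l)}"

definition maj_mat :: "nat \<Rightarrow> nat \<Rightarrow> nat \<Rightarrow> nat mat" where
  "maj_mat n k l = mat k l (\<lambda>(i, j). maj_count n k l i j)"

definition ones_mat :: "nat \<Rightarrow> nat \<Rightarrow> nat mat" where
  "ones_mat a b = mat a b (\<lambda>_. 1)"

end

theory Submission
  imports Defs "HOL-Library.Sublist" "HOL-Combinatorics.Multiset_Permutations"
    "HOL-Computational_Algebra.Polynomial"
begin

text \<open>
  By the symmetry \<open>\<pi> \<mapsto> \<pi>\<^sup>-\<^sup>1\<close> it suffices that, for each set \<open>D\<close>, the number of permutations with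
  \<open>maj \<pi> \<equiv> i\<close> (mod \<open>p\<close>) whose inverse has descent set \<open>D\<close> is the same for all \<open>i\<close> not divisible by \<open>p\<close>,
  that is, that \<open>\<Sum> q\<^bsup>maj \<pi>\<^esup>\<close> over these permutations is constant modulo the cyclotomic polynomial
  \<open>1 + q + \<dots> + q\<^bsup>p-1\<^esup>\<close>. By inclusion-exclusion the descent set may be required to be contained in \<open>D\<close>
  instead. The permutations are then iterated shuffles of increasing runs, so the sum is a product of
  \<open>q\<close>-binomial coefficients, the outermost of which is \<open>[n choose c]\<close>. If \<open>n\<close> is congruent to 0 or 1,
  this factor either vanishes modulo the cyclotomic polynomial, or it is constant and \<open>n - c\<close> is again
  congruent to 0 or 1.
\<close>

subsection \<open>Gaussian binomial coefficients\<close>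

text \<open>\<open>qbinom q a b\<close> is the \<open>q\<close>-binomial coefficient \<open>[a + b choose a]\<close>.\<close>

fun qbinom :: "'a::comm_ring_1 \<Rightarrow> nat \<Rightarrow> nat \<Rightarrow> 'a" where
  "qbinom q 0 b = 1"
| "qbinom q (Suc a) 0 = 1"
| "qbinom q (Suc a) (Suc b) = qbinom q a (Suc b) + q ^ Suc a * qbinom q (Suc a) b"

lemma qbinom_0_right [simp]: "qbinom q a 0 = 1"
  by (cases a) auto

text \<open>The second q-Pascal rule: expand both terms of the defining rule by the induction
  hypothesis, then regroup by the defining rule.\<close>

lemma qbinom_Suc_Suc':
  "qbinom q (Suc a) (Suc b) = q ^ Suc b * qbinom q a (Suc b) + qbinom q (Suc a) b"
proof (induction "a + b" arbitrary: a b rule: less_induct)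
  case less
  show ?case
  proof (cases a; cases b)
    fix b' assume "a = 0" "b = Suc b'"
    then show ?thesis using less[of 0 b'] by (simp add: algebra_simps)
  next
    fix a' assume a: "a = Suc a'" "b = 0"
    have IH: "qbinom q a (Suc 0) = q * qbinom q a' (Suc 0) + 1"
      using less[of a' 0] a by simp
    have "qbinom q (Suc a) (Suc 0) = qbinom q a (Suc 0) + q * q ^ a"
      by simp
    also have "\<dots> = q * (qbinom q a' (Suc 0) + q ^ a) + 1"
      by (subst IH) (simp add: algebra_simps)
    also have "qbinom q a' (Suc 0) + q ^ a = qbinom q a (Suc 0)"
      using a by simp
    finally show ?thesis using a by simp
  next
    fix a' b' assume ab: "a = Suc a'" "b = Suc b'"
    have *: "qbinom q a (Suc b) = q ^ Suc b * qbinom q a' (Suc b) + qbinom q a b"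
      "qbinom q (Suc a) b = q ^ b * qbinom q a b + qbinom q (Suc a) b'"
      using less[of a' b] less[of a b'] ab by simp_all
    have "qbinom q (Suc a) (Suc b) = qbinom q a (Suc b) + q ^ Suc a * qbinom q (Suc a) b"
      by simp
    also have "\<dots> = q ^ Suc b * (qbinom q a' (Suc b) + q ^ a * qbinom q a b)
        + (qbinom q a b + q ^ Suc a * qbinom q (Suc a) b')"
      by (subst *(1), subst *(2)) (simp add: algebra_simps)
    also have "qbinom q a' (Suc b) + q ^ a * qbinom q a b = qbinom q a (Suc b)"
      using ab by simp
    also have "qbinom q a b + q ^ Suc a * qbinom q (Suc a) b' = qbinom q (Suc a) b"
      using ab by simp
    finally show ?thesis .
  qed (auto simp: algebra_simps)
qed

lemma qbinom_commute: "qbinom q a b = qbinom q b a"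
proof (induction q a b rule: qbinom.induct)
  case (3 q a b)
  then show ?case
    by (subst qbinom_Suc_Suc') simp
qed auto

definition qnum :: "'a::comm_ring_1 \<Rightarrow> nat \<Rightarrow> 'a" where
  "qnum q n = (\<Sum>i<n. q ^ i)"

lemma qnum_add: "qnum q (m + n) = qnum q m + q ^ m * qnum q n"
  by (induction n) (auto simp: qnum_def algebra_simps power_add)

lemma qnum_mult: "qnum q (m * n) = qnum q m * qnum (q ^ m) n"
proof (induction n)
  case (Suc n)
  have "qnum q (m * Suc n) = qnum q (m * n + m)"
    by (simp add: add.commute)
  also have "\<dots> = qnum q m * (qnum (q ^ m) n + (q ^ m) ^ n)"
    by (simp only: qnum_add Suc) (simp add: algebra_simps power_mult)
  finally show ?case by (simp add: qnum_def)
qed (simp add: qnum_def)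

text \<open>A division-free substitute for the factorial formula, usable where q-numbers
  vanish.\<close>

lemma qbinom_absorb: "qnum q (Suc a) * qbinom q (Suc a) b = qnum q (Suc a + b) * qbinom q a b"
proof (induction "a + b" arbitrary: a b rule: less_induct)
  case less
  show ?case
  proof (cases b)
    case (Suc c)
    have 1: "qnum q (Suc a) * qbinom q (Suc a) c = qnum q (Suc a + c) * qbinom q a c"
      using less[of a c] Suc by simp
    have 2: "qnum q (Suc c) * qbinom q a (Suc c) = qnum q (Suc c + a) * qbinom q a c"
      using less[of c a] Suc by (simp add: qbinom_commute add.commute)
    have "qnum q (Suc a) * qbinom q (Suc a) b
        = qnum q (Suc a) * qbinom q a b + q ^ Suc a * (qnum q (Suc a) * qbinom q (Suc a) c)"
      by (simp add: Suc algebra_simps)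
    also have "\<dots> = qnum q (Suc a) * qbinom q a b + q ^ Suc a * (qnum q b * qbinom q a b)"
      using 1 2 Suc by (simp add: add.commute)
    also have "\<dots> = qnum q (Suc a + b) * qbinom q a b"
      unfolding qnum_add by (simp only: algebra_simps)
    finally show ?thesis .
  qed auto
qed

subsection \<open>Major index of shuffles\<close>

text \<open>
  Words are stored from right to left, so that a descent between the two rightmost letters, which is
  found at the head of the list, contributes the number of letters after the head.
\<close>

fun rev_maj :: "nat list \<Rightarrow> nat" where
  "rev_maj (y # x # w) = rev_maj (x # w) + (if y < x then Suc (length w) else 0)"
| "rev_maj _ = 0"

lemma rev_maj_Cons_greater: "\<forall>x\<in>set w. x < y \<Longrightarrow> rev_maj (y # w) = rev_maj w"
  by (cases w) auto

lemma rev_maj_sorted: "sorted_wrt (>) w \<Longrightarrow> rev_maj w = 0"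
  by (induction w rule: rev_maj.induct) auto

lemma sum_Cons_shuffles:
  fixes x y :: nat
  assumes "x < y"
  shows "(\<Sum>w\<in>shuffles (x # us) (y # ys). f w)
    = (\<Sum>w\<in>shuffles us (y # ys). f (x # w)) + (\<Sum>w\<in>shuffles (x # us) ys. f (y # w))"
proof -
  have "(\<Sum>w\<in>shuffles (x # us) (y # ys). f w)
      = sum f ((#) x ` shuffles us (y # ys)) + sum f ((#) y ` shuffles (x # us) ys)"
    using assms by (simp, intro sum.union_disjoint) auto
  then show ?thesis by (simp add: sum.reindex)
qed

text \<open>
  The second conjunct, for shuffles extended by a small rightmost letter, only strengthens the induction.
\<close>

lemma sum_shuffles_rev_maj:
  fixes q :: "'a::comm_ring_1"
  assumes "sorted_wrt (>) ys" "\<And>x y. x \<in> set us \<Longrightarrow> y \<in> set ys \<Longrightarrow> x < y"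
  shows "(\<Sum>w\<in>shuffles us ys. q ^ rev_maj w) = q ^ rev_maj us * qbinom q (length ys) (length us)
    \<and> (\<forall>x. (\<forall>y\<in>set ys. x < y) \<longrightarrow> (\<Sum>w\<in>shuffles us ys. q ^ rev_maj (x # w))
      = q ^ (rev_maj (x # us) + length ys) * qbinom q (length ys) (length us))"
  using assms
proof (induction us ys rule: shuffles.induct)
  case (1 ys)
  then show ?case by (cases ys) (auto simp: rev_maj_sorted)
next
  case (2 us)
  then show ?case by simp
next
  case (3 z us y ys)
  have greater: "\<forall>x\<in>set w. x < y" if "w \<in> shuffles (z # us) ys" for w
    using that 3(3,4) by (auto dest!: set_shuffles)
  define c where "c = length ys"
  define m where "m = length us"
  define Q where "Q = q ^ rev_maj (z # us)"
  \<comment> \<open>The second conjunct is used here, with \<open>z\<close> as the small letter at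
    the head.\<close>
  have A: "(\<Sum>w\<in>shuffles us (y # ys). q ^ rev_maj (z # w)) = Q * q ^ Suc c * qbinom q (Suc c) m"
    using "3.IH"(1) 3(3,4) by (simp add: Q_def m_def c_def power_add)
  have B: "(\<Sum>w\<in>shuffles (z # us) ys. q ^ rev_maj (y # w)) = Q * qbinom q c (Suc m)"
    using "3.IH"(2) 3(3,4) greater
    by (simp add: Q_def m_def c_def rev_maj_Cons_greater cong: sum.cong)
  have zy: "z < y"
    using 3(4) by simp
  have "(\<Sum>w\<in>shuffles (z # us) (y # ys). q ^ rev_maj w) = Q * qbinom q (Suc c) (Suc m)"
    by (simp only: sum_Cons_shuffles[OF zy] A B qbinom.simps(3) algebra_simps)
  moreover have "(\<Sum>w\<in>shuffles (z # us) (y # ys). q ^ rev_maj (x # w))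
      = q ^ rev_maj (x # z # us) * q ^ Suc c * qbinom q (Suc c) (Suc m)"
    if x: "\<forall>y\<in>set (y # ys). x < y" for x
  proof -
    \<comment> \<open>\<open>K\<close> counts the letters after \<open>x\<close>, hence is the
      contribution of a descent at \<open>x\<close>.\<close>
    define K where "K = Suc (Suc (m + c))"
    have "(\<Sum>w\<in>shuffles (z # us) (y # ys). q ^ rev_maj (x # w))
      = (\<Sum>w\<in>shuffles us (y # ys). q ^ rev_maj (x # z # w))
        + (\<Sum>w\<in>shuffles (z # us) ys. q ^ rev_maj (x # y # w))"
      by (rule sum_Cons_shuffles[OF zy])
    also have "(\<Sum>w\<in>shuffles us (y # ys). q ^ rev_maj (x # z # w))
      = (\<Sum>w\<in>shuffles us (y # ys). (if x < z then q ^ K else 1) * q ^ rev_maj (z # w))"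
      by (intro sum.cong)
        (auto simp: K_def m_def c_def power_add algebra_simps dest!: length_shuffles)
    also have "\<dots> = (if x < z then q ^ K else 1) * (Q * q ^ Suc c * qbinom q (Suc c) m)"
      using A by (simp flip: sum_distrib_left)
    also have "(\<Sum>w\<in>shuffles (z # us) ys. q ^ rev_maj (x # y # w))
      = (\<Sum>w\<in>shuffles (z # us) ys. q ^ K * q ^ rev_maj (y # w))"
      using x by (intro sum.cong)
        (auto simp: K_def m_def c_def power_add algebra_simps dest!: length_shuffles)
    also have "\<dots> = q ^ K * (Q * qbinom q c (Suc m))"
      using B by (simp flip: sum_distrib_left)
    \<comment> \<open>If \<open>x < z\<close>, both terms carry \<open>q ^ K\<close> and the
      defining Pascal rule combines them. Otherwise only the second does, and the other Pascal rule
      applies.\<close>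
    also have "(if x < z then q ^ K else 1) * (Q * q ^ Suc c * qbinom q (Suc c) m)
        + q ^ K * (Q * qbinom q c (Suc m))
      = Q * (if x < z then q ^ Suc m else 1) * q ^ Suc c * qbinom q (Suc c) (Suc m)"
    proof (cases "x < z")
      case True
      then show ?thesis
        by (simp add: K_def power_add algebra_simps)
    next
      case False
      then show ?thesis
        by (simp add: qbinom_Suc_Suc' K_def power_add algebra_simps del: qbinom.simps(3))
    qed
    also have "Q * (if x < z then q ^ Suc m else 1) = q ^ rev_maj (x # z # us)"
      by (simp add: Q_def m_def power_add)
    finally show ?thesis .
  qed
  ultimately show ?case
    by (auto simp add: power_add c_def m_def Q_def simp del: rev_maj.simps qbinom.simps)
qed

subsection \<open>Constants modulo the cyclotomic polynomial\<close>

text \<open>Rational coefficients make positive integers invertible, as needed in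
  \<open>qbinom_const_mod_multiples\<close>.\<close>

abbreviation X :: "rat poly" where "X \<equiv> monom 1 (Suc 0)"

text \<open>For prime \<open>p\<close> this is the \<open>p\<close>-th cyclotomic polynomial.\<close>

definition cyc :: "nat \<Rightarrow> rat poly" where "cyc p = qnum X p"

lemma X_power: "X ^ k = monom 1 k"
  by (simp add: monom_power)

lemma coeff_cyc: "coeff (cyc p) k = (if k < p then 1 else 0)"
  by (simp add: cyc_def qnum_def X_power coeff_sum)

lemma cyc_nonzero: "0 < p \<Longrightarrow> cyc p \<noteq> 0"
  using coeff_cyc[of p 0] by auto

lemma degree_cyc: "degree (cyc p) = p - 1"
proof (cases "p = 0")
  case False
  have "degree (cyc p) \<le> p - 1"
    by (intro degree_le) (auto simp: coeff_cyc)
  moreover have "p - 1 \<le> degree (cyc p)"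
    using False by (intro le_degree) (simp add: coeff_cyc)
  ultimately show ?thesis by simp
qed (simp add: cyc_def qnum_def)

definition const_mod :: "nat \<Rightarrow> rat poly \<Rightarrow> bool" where
  "const_mod p P \<longleftrightarrow> (\<exists>c. [P = [:c:]] (mod cyc p))"

lemma const_mod_cong: "[P = Q] (mod cyc p) \<Longrightarrow> const_mod p Q \<Longrightarrow> const_mod p P"
  unfolding const_mod_def by (blast intro: cong_trans)

lemma const_mod_const: "const_mod p [:c:]"
  unfolding const_mod_def by (blast intro: cong_refl)

lemma const_mod_0: "const_mod p 0"
  using const_mod_const[of p 0] by simp

lemma const_mod_1: "const_mod p 1"
  using const_mod_const[of p 1] by (simp add: one_pCons)

lemma const_mod_diff: "const_mod p P \<Longrightarrow> const_mod p Q \<Longrightarrow> const_mod p (P - Q)"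
  unfolding const_mod_def by (metis cong_diff diff_pCons diff_0_right)

lemma const_mod_add: "const_mod p P \<Longrightarrow> const_mod p Q \<Longrightarrow> const_mod p (P + Q)"
  unfolding const_mod_def by (metis cong_add add_pCons add_0_right)

lemma const_mod_mult:
  assumes "const_mod p P" "const_mod p Q"
  shows "const_mod p (P * Q)"
proof -
  obtain c d where "[P = [:c:]] (mod cyc p)" "[Q = [:d:]] (mod cyc p)"
    using assms unfolding const_mod_def by blast
  then have "[P * Q = [:c:] * [:d:]] (mod cyc p)" by (rule cong_mult)
  then show ?thesis by (rule const_mod_cong) (simp add: const_mod_const)
qed

lemma const_mod_sum: "(\<And>x. x \<in> S \<Longrightarrow> const_mod p (f x)) \<Longrightarrow> const_mod p (sum f S)"
  by (induction S rule: infinite_finite_induct) (auto intro: const_mod_add const_mod_0)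

lemma X_power_cong_1: "[X ^ (p * k) = 1] (mod cyc p)"
proof -
  have "[X ^ p = 1] (mod cyc p)"
    unfolding cong_iff_dvd_diff cyc_def qnum_def by (simp only: power_diff_1_eq dvd_triv_right)
  from cong_pow[OF this, of k] show ?thesis by (simp only: power_mult power_one)
qed

lemma X_power_mod_cong: "[X ^ k = X ^ (k mod p)] (mod cyc p)"
proof -
  have "X ^ k = X ^ (p * (k div p)) * X ^ (k mod p)"
    by (simp only: flip: power_add) simp
  also have "[\<dots> = 1 * X ^ (k mod p)] (mod cyc p)"
    by (intro cong_mult X_power_cong_1 cong_refl)
  finally show ?thesis by simp
qed

section \<open>q-numbers and q-binomial coefficients modulo the cyclotomic polynomial\<close>

lemma qnum_cong_0: "p dvd n \<Longrightarrow> [qnum X n = 0] (mod cyc p)"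
  by (elim dvdE) (simp only: qnum_mult cyc_def cong_mult_self_left)

lemma qnum_add_cong:
  assumes "p dvd m"
  shows "[qnum X (k + m) = qnum X k] (mod cyc p)"
proof -
  have "[qnum X k + X ^ k * qnum X m = qnum X k + X ^ k * 0] (mod cyc p)"
    using assms by (intro cong_add cong_mult qnum_cong_0 cong_refl)
  then show ?thesis by (simp only: qnum_add mult_zero_right add_0_right)
qed

text \<open>If \<open>k * l = 1 + m * p\<close>, then \<open>qnum X k * qnum (X ^ k) l\<close>
  equals \<open>qnum X (1 + m * p)\<close>, which reduces to 1.\<close>

lemma qnum_unit:
  assumes "prime p" "\<not> p dvd k"
  obtains u where "[qnum X k * u = 1] (mod cyc p)"
proof -
  have "coprime k p"
    using assms by (metis coprime_commute prime_imp_coprime)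
  then obtain l where "[k * l = 1] (mod p)"
    using cong_solve_coprime_nat by auto
  then obtain m where m: "k * l = 1 + m * p"
    using assms unfolding cong_to_1'_nat by (auto simp: prime_gt_1_nat)
  have "qnum X k * qnum (X ^ k) l = qnum X (1 + m * p)"
    by (metis m qnum_mult)
  also have "[\<dots> = qnum X 1] (mod cyc p)"
    by (rule qnum_add_cong) simp
  also have "qnum X 1 = 1"
    by (simp add: qnum_def)
  finally show ?thesis by (rule that)
qed

lemma qnum_cancel:
  assumes "prime p" "\<not> p dvd k" "[qnum X k * P = qnum X k * Q] (mod cyc p)"
  shows "[P = Q] (mod cyc p)"
proof -
  obtain u where u: "[qnum X k * u = 1] (mod cyc p)"
    using qnum_unit assms by blast
  have *: "[qnum X k * R * u = R] (mod cyc p)" for R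
    using cong_mult[OF u cong_refl[of R]] by (simp add: mult_ac)
  have "[P = qnum X k * P * u] (mod cyc p)"
    by (rule cong_sym[OF *])
  also have "[qnum X k * P * u = qnum X k * Q * u] (mod cyc p)"
    by (intro cong_mult assms cong_refl)
  also have "[qnum X k * Q * u = Q] (mod cyc p)"
    by (rule *)
  finally show ?thesis .
qed

text \<open>By absorption, multiplying by the unit \<open>qnum X a\<close> produces the factor
  \<open>qnum X (a + b)\<close>, which vanishes.\<close>

lemma qbinom_cong_0:
  assumes "prime p" "p dvd a + b" "\<not> p dvd a"
  shows "[qbinom X a b = 0] (mod cyc p)"
proof (rule qnum_cancel)
  obtain c where c: "a = Suc c"
    using assms by (cases a) auto
  have "qnum X a * qbinom X a b = qnum X (a + b) * qbinom X c b"
    unfolding c by (rule qbinom_absorb)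
  also have "[\<dots> = 0 * qbinom X c b] (mod cyc p)"
    using assms by (intro cong_mult qnum_cong_0 cong_refl)
  finally show "[qnum X a * qbinom X a b = qnum X a * 0] (mod cyc p)"
    by simp
qed (use assms in auto)

text \<open>A case of the q-Lucas theorem. Raising the first argument one by one from
  \<open>p * j\<close> changes nothing modulo \<open>cyc p\<close> until \<open>p * Suc j\<close> is
  reached, where absorption degenerates.\<close>

lemma qbinom_const_mod_multiples:
  assumes p: "prime p"
  shows "const_mod p (qbinom X (p * j) (p * m))"
proof (induction j)
  case (Suc j)
  let ?B = "\<lambda>a. qbinom X a (p * m)"
  have below: "[?B (p * j + i) = ?B (p * j)] (mod cyc p)" if "i < p" for i
    using that
  proof (induction i)
    case (Suc i)
    let ?a = "p * j + i"
    have "\<not> p dvd Suc ?a"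
      using Suc.prems by (metis add_Suc_right dvd_add_right_iff dvd_triv_left nat_dvd_not_less zero_less_Suc)
    \<comment> \<open>The two q-numbers of the absorption identity differ by \<open>p * m\<close> in
      index, so they are congruent.\<close>
    moreover have "[qnum X (Suc ?a) * ?B (Suc ?a) = qnum X (Suc ?a) * ?B ?a] (mod cyc p)"
      unfolding qbinom_absorb by (intro cong_mult qnum_add_cong cong_refl) simp
    ultimately have "[?B (Suc ?a) = ?B ?a] (mod cyc p)"
      using qnum_cancel[OF p] by blast
    also have "[?B ?a = ?B (p * j)] (mod cyc p)"
      using Suc by simp
    finally show ?case by simp
  qed simp
  define P where "P = ?B (p * j + (p - 1))"
  have "const_mod p P"
    unfolding P_def using p by (intro const_mod_cong[OF below Suc.IH]) (simp add: prime_gt_0_nat)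
  have last: "Suc (p * j + (p - 1)) = p * Suc j"
    using prime_gt_0_nat[OF p] by simp
  \<comment> \<open>Both \<open>q\<close>-numbers in the absorption identity at \<open>p * Suc j\<close> vanish modulo \<open>cyc p\<close>; after division
    by \<open>cyc p\<close> they become \<open>q\<close>-numbers at \<open>X ^ p\<close>, which are congruent to ordinary integers.\<close>
  have num: "[qnum (X ^ p) k = of_nat k] (mod cyc p)" for k
  proof -
    have "[qnum (X ^ p) k = (\<Sum>i<k. 1)] (mod cyc p)"
      unfolding qnum_def by (intro cong_sum) (simp only: flip: power_mult, rule X_power_cong_1)
    then show ?thesis by simp
  qed
  have "qnum X (p * Suc j) * ?B (p * Suc j) = qnum X (p * (Suc j + m)) * P"
    using qbinom_absorb[of X "p * j + (p - 1)" "p * m"] unfolding last P_def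
    by (simp only: distrib_left)
  then have "cyc p * (qnum (X ^ p) (Suc j) * ?B (p * Suc j)) = cyc p * (qnum (X ^ p) (Suc j + m) * P)"
    by (simp only: qnum_mult cyc_def mult.assoc)
  then have eq: "qnum (X ^ p) (Suc j) * ?B (p * Suc j) = qnum (X ^ p) (Suc j + m) * P"
    using cyc_nonzero[OF prime_gt_0_nat[OF p]] by (simp only: mult_cancel_left) simp
  have "[of_nat (Suc j) * ?B (p * Suc j) = qnum (X ^ p) (Suc j) * ?B (p * Suc j)] (mod cyc p)"
    by (intro cong_mult cong_refl cong_sym[OF num])
  also have "qnum (X ^ p) (Suc j) * ?B (p * Suc j) = qnum (X ^ p) (Suc j + m) * P"
    by (rule eq)
  also have "[\<dots> = of_nat (Suc j + m) * P] (mod cyc p)"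
    by (intro cong_mult cong_refl num)
  finally have "const_mod p (of_nat (Suc j) * ?B (p * Suc j))"
    by (rule const_mod_cong) (unfold of_nat_poly, intro const_mod_mult const_mod_const \<open>const_mod p P\<close>)
  then have "const_mod p ([:1 / of_nat (Suc j):] * (of_nat (Suc j) * ?B (p * Suc j)))"
    by (rule const_mod_mult[OF const_mod_const])
  also have "[:1 / of_nat (Suc j):] * (of_nat (Suc j) * ?B (p * Suc j)) = ?B (p * Suc j)"
    by (simp add: of_nat_poly mult.assoc[symmetric] del: of_nat_Suc mult_Suc_right flip: one_pCons)
  finally show ?case .
qed (simp add: const_mod_1)

text \<open>The residue of \<open>a\<close> decides which alternative holds. The condition on
  \<open>b\<close> lets the recursion on the word length continue.\<close>

lemma qbinom_const_mod:
  assumes p: "prime p" and ab: "p dvd a + b \<or> [a + b = 1] (mod p)"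
  shows "[qbinom X a b = 0] (mod cyc p)
    \<or> (p dvd b \<or> [b = 1] (mod p)) \<and> const_mod p (qbinom X a b)"
proof -
  have one: "[Suc x = 1] (mod p) \<longleftrightarrow> p dvd x" for x
    using cong_add_rcancel_0_nat[of x 1 p] by (simp add: cong_0_iff)
  have not_dvd_Suc: "\<not> p dvd Suc x" if "p dvd x" for x
  proof
    assume "p dvd Suc x"
    then have "p dvd Suc x - x" using that by (rule dvd_diff_nat)
    then show False using prime_gt_1_nat[OF p] by simp
  qed
  have mult: "const_mod p (qbinom X a b)" if "p dvd a" "p dvd b" for a b
    using that qbinom_const_mod_multiples[OF p] by (auto elim!: dvdE)
  consider (0) "p dvd a + b" "p dvd a" | (1) "p dvd a + b" "\<not> p dvd a"
    | (2) "[a + b = 1] (mod p)" "p dvd a" | (3) "[a + b = 1] (mod p)" "[a = 1] (mod p)"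
    | (4) "[a + b = 1] (mod p)" "\<not> p dvd a" "\<not> [a = 1] (mod p)"
    using ab by blast
  then show ?thesis
  proof cases
    case 0
    then have "p dvd b" by (simp add: dvd_add_right_iff)
    then show ?thesis using mult 0 by blast
  next
    case 1
    then show ?thesis using qbinom_cong_0 p by blast
  next
    \<comment> \<open>For \<open>a > 0\<close>, the term with \<open>a - 1\<close> in the second
      Pascal rule vanishes, leaving arguments \<open>a\<close> and \<open>b - 1\<close>, both
      multiples of \<open>p\<close>.\<close>
    case 2
    have b: "[b = 1] (mod p)"
      using 2 by (auto simp: cong_def elim!: dvdE)
    obtain d where d: "b = Suc d"
      using b p by (cases b) (auto simp: cong_def)
    have pd: "p dvd d"
      using b one[of d] d by simp
    have "const_mod p (qbinom X a b)"
    proof (cases a)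
      case (Suc c)
      have "\<not> p dvd c"
        using 2 not_dvd_Suc[of c] Suc by blast
      moreover have "p dvd c + b"
        using dvd_add[OF 2(2) pd] Suc d by simp
      ultimately have "[qbinom X c b = 0] (mod cyc p)"
        using qbinom_cong_0 p by blast
      then have "[X ^ b * qbinom X c b + qbinom X a d = X ^ b * 0 + qbinom X a d] (mod cyc p)"
        by (intro cong_add cong_mult cong_refl)
      then have "[qbinom X a b = qbinom X a d] (mod cyc p)"
        using qbinom_Suc_Suc'[of X c d] Suc d by simp
      then show ?thesis
        using mult 2 pd by (blast intro: const_mod_cong)
    qed (simp add: const_mod_1)
    then show ?thesis using b by blast
  next
    \<comment> \<open>Mirror image of the previous case: the defining Pascal rule loses its term
      with \<open>b - 1\<close> and leaves \<open>a - 1\<close> and \<open>b\<close>.\<close>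
    case 3
    obtain c where c: "a = Suc c"
      using 3 p by (cases a) (auto simp: cong_def)
    have pc: "p dvd c"
      using 3 one[of c] c by simp
    have pcb: "p dvd c + b"
      using 3 one[of "c + b"] c by simp
    then have b: "p dvd b"
      using pc by (simp add: dvd_add_right_iff)
    have "const_mod p (qbinom X a b)"
    proof (cases b)
      case (Suc d)
      have "\<not> p dvd a"
        using not_dvd_Suc[OF pc] c by simp
      moreover have "p dvd a + d"
        using pcb c Suc by simp
      ultimately have "[qbinom X a d = 0] (mod cyc p)"
        using qbinom_cong_0 p by blast
      then have "[qbinom X c b + X ^ a * qbinom X a d = qbinom X c b + X ^ a * 0] (mod cyc p)"
        by (intro cong_add cong_mult cong_refl)
      then have "[qbinom X a b = qbinom X c b] (mod cyc p)"
        using qbinom.simps(3)[of X c d] Suc c by simp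
      then show ?thesis
        using mult pc b by (blast intro: const_mod_cong)
    qed (simp add: const_mod_1)
    then show ?thesis using b by blast
  next
    \<comment> \<open>Here \<open>qnum X a\<close> is a unit, and absorption leads to the
      coefficient at \<open>a - 1\<close>, which vanishes.\<close>
    case 4
    obtain c where c: "a = Suc c"
      using 4 by (cases a) auto
    have "p dvd c + b"
      using 4 one[of "c + b"] c by simp
    moreover have "\<not> p dvd c"
      using 4 one[of c] c by simp
    ultimately have "[qbinom X c b = 0] (mod cyc p)"
      using qbinom_cong_0 p by blast
    then have "[qnum X (a + b) * qbinom X c b = qnum X (a + b) * 0] (mod cyc p)"
      by (intro cong_mult cong_refl)
    then have "[qnum X a * qbinom X a b = qnum X a * 0] (mod cyc p)"
      using qbinom_absorb[of X c b] c by simp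
    then show ?thesis using qnum_cancel p 4 by blast
  qed
qed

text \<open>Reducing exponents modulo \<open>p\<close> gives a polynomial of degree at most
  \<open>p - 1\<close>. Its difference from a constant is then a scalar multiple of
  \<open>cyc p\<close>, whose coefficients up to \<open>p - 1\<close> are all 1; the constant only
  affects residue 0.\<close>

lemma const_mod_imp_card_eq:
  assumes "const_mod p (\<Sum>x\<in>W. X ^ f x)" "finite W" "i \<in> {0<..<p}" "i' \<in> {0<..<p}"
  shows "card {x \<in> W. [f x = i] (mod p)} = card {x \<in> W. [f x = i'] (mod p)}"
proof -
  obtain c where c: "[(\<Sum>x\<in>W. X ^ f x) = [:c:]] (mod cyc p)"
    using assms unfolding const_mod_def by blast
  define R where "R = (\<Sum>x\<in>W. X ^ (f x mod p))"
  have coeff_R: "coeff R k = of_nat (card {x \<in> W. [f x = k] (mod p)})" if "k < p" for k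
    using that assms(2) by (simp add: R_def X_power coeff_sum cong_def sum.If_cases Int_def)
  have "[R = (\<Sum>x\<in>W. X ^ f x)] (mod cyc p)"
    unfolding R_def by (intro cong_sum cong_sym[OF X_power_mod_cong])
  then have "[R = [:c:]] (mod cyc p)"
    using c by (rule cong_trans)
  then obtain Q where Q: "R - [:c:] = cyc p * Q"
    by (auto simp: cong_iff_dvd_diff elim: dvdE)
  have "degree R \<le> p - 1"
  proof (intro degree_le allI impI)
    fix k assume "p - 1 < k"
    then have "f x mod p \<noteq> k" for x
      using assms(3) mod_less_divisor[of p "f x"] by (intro notI) simp
    then show "coeff R k = 0" by (simp add: R_def X_power coeff_sum)
  qed
  then have "degree (R - [:c:]) \<le> p - 1"
    by (intro degree_diff_le) auto
  then have "degree Q = 0"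
  proof (cases "Q = 0")
    case False
    then have "degree (cyc p * Q) = p - 1 + degree Q"
      using cyc_nonzero[of p] assms(3) by (subst degree_mult_eq) (simp_all add: degree_cyc)
    then show ?thesis
      using \<open>degree (R - [:c:]) \<le> p - 1\<close> unfolding Q by linarith
  qed simp
  then obtain t where t: "Q = [:t:]"
    by (metis degree_eq_zeroE)
  have "coeff R k = t" if "k \<in> {0<..<p}" for k
    using arg_cong[OF Q, of "\<lambda>P. coeff P k"] that
    by (cases k) (auto simp: t coeff_cyc)
  then have "(of_nat (card {x \<in> W. [f x = i] (mod p)}) :: rat) = of_nat (card {x \<in> W. [f x = i'] (mod p)})"
    using assms(3,4) by (simp flip: coeff_R)
  then show ?thesis by simp
qed

subsection \<open>Inverse descent classes\<close>

text \<open>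
  As words are reversed, \<open>v\<close> preceding \<open>Suc v\<close> in the list means that \<open>Suc v\<close> stands to the left of \<open>v\<close>.
\<close>

definition inv_descents :: "nat list \<Rightarrow> nat set" where
  "inv_descents w = {v. subseq [v, Suc v] w}"

lemma inv_descents_in_set: "v \<in> inv_descents w \<Longrightarrow> v \<in> set w \<and> Suc v \<in> set w"
  unfolding inv_descents_def by (induction w) (auto split: if_splits simp: subseq_singleton_left)

lemma subseq_inv_descents: "subseq u w \<Longrightarrow> inv_descents u \<subseteq> inv_descents w"
  unfolding inv_descents_def using subseq_order.order_trans by blast

lemma inv_descents_filter:
  "v \<in> inv_descents w \<Longrightarrow> P v \<Longrightarrow> P (Suc v) \<Longrightarrow> v \<in> inv_descents (filter P w)"
  unfolding inv_descents_def using subseq_filter[of "[v, Suc v]" w P] by simp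

lemma subseq_pair_sorted_wrt: "sorted_wrt R w \<Longrightarrow> subseq [x, y] w \<Longrightarrow> R x y"
  by (induction w) (auto split: if_splits simp: subseq_singleton_left)

lemma sorted_rev_upt: "sorted_wrt (>) (rev [a..<b])"
  by (simp add: sorted_wrt_rev)

lemma inv_descents_rev_upt: "inv_descents (rev [a..<b]) = {}"
  using subseq_pair_sorted_wrt[OF sorted_rev_upt] by (fastforce simp: inv_descents_def)

text \<open>If the head \<open>x\<close> were not the largest letter, \<open>Suc x\<close> would
  come later and make \<open>x\<close> an inverse descent.\<close>

lemma inv_descents_empty_imp:
  assumes "distinct w" "set w = {a..<b}" "inv_descents w = {}"
  shows "w = rev [a..<b]"
  using assms
proof (induction w arbitrary: b)
  case (Cons x w)
  have x: "a \<le> x" "x < b" using Cons.prems by auto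
  have "Suc x \<notin> set w"
    using Cons.prems(3) subseq_Cons2_iff[of x "[Suc x]" x w]
    by (auto simp: inv_descents_def subseq_singleton_left simp del: subseq_Cons2_iff)
  moreover have "Suc x \<in> set (x # w)" if "Suc x < b"
    using Cons.prems(2) x that by auto
  ultimately have b: "b = Suc x" using x by force
  have "w = rev [a..<x]"
  proof (rule Cons.IH)
    have "set w = set (x # w) - {x}" using Cons.prems by auto
    also have "\<dots> = {a..<Suc x} - {x}" using Cons.prems(2) b by simp
    also have "\<dots> = {a..<x}" by auto
    finally show "set w = {a..<x}" .
    show "inv_descents w = {}"
      using Cons.prems(3) subseq_inv_descents[of w "x # w"] by auto
  qed (use Cons.prems in auto)
  then show ?case using b x by simp
qed auto

lemma inv_descents_perm:
  assumes "w \<in> permutations_of_set {1..n}"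
  shows "inv_descents w \<subseteq> {1..<n}"
proof
  fix v assume v: "v \<in> inv_descents w"
  then have "v \<in> set w" "Suc v \<in> set w"
    using inv_descents_in_set by blast+
  then show "v \<in> {1..<n}"
    using assms by (auto simp: permutations_of_set_def)
qed

text \<open>Later this makes the shuffle sets of different words \<open>u\<close> with the same run
  disjoint.\<close>

lemma filter_shuffles_separated:
  assumes "\<And>x. x \<in> set xs \<Longrightarrow> P x" "\<And>y. y \<in> set ys \<Longrightarrow> \<not> P y" "w \<in> shuffles xs ys"
  shows "filter P w = xs" "filter (\<lambda>x. \<not> P x) w = ys"
proof -
  have "w \<in> List.partition P -` {(xs, ys)}"
    using assms by (subst inv_image_partition) auto
  then show "filter P w = xs" "filter (\<lambda>x. \<not> P x) w = ys"
    by (auto simp: o_def)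
qed

text \<open>No value above \<open>m\<close> may be an inverse descent, so the letters above
  \<open>m\<close> occur in one fixed order. As \<open>m\<close> itself is allowed, they interleave
  freely with a word on \<open>{1..m}\<close>.\<close>

lemma perms_split:
  assumes S: "S \<subseteq> {1..<m}" and "m < n"
  shows "{w \<in> permutations_of_set {1..n}. inv_descents w \<subseteq> insert m S}
    = (\<Union>u\<in>{u \<in> permutations_of_set {1..m}. inv_descents u \<subseteq> S}. shuffles u (rev [Suc m..<Suc n]))"
    (is "?L = ?R")
proof (intro equalityI subsetI)
  fix w assume "w \<in> ?L"
  then have w: "set w = {1..n}" "distinct w" "inv_descents w \<subseteq> insert m S"
    by (auto simp: permutations_of_set_def)
  define u where "u = filter (\<lambda>v. v \<le> m) w"
  define y where "y = filter (\<lambda>v. \<not> v \<le> m) w"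
  have u: "u \<in> permutations_of_set {1..m}"
    using w \<open>m < n\<close> by (auto simp: permutations_of_set_def u_def)
  have "inv_descents u \<subseteq> inv_descents w" "inv_descents y \<subseteq> inv_descents w"
    unfolding u_def y_def by (intro subseq_inv_descents subseq_filter_left)+
  then have "inv_descents u \<subseteq> S" "inv_descents y \<subseteq> insert m S"
    using w inv_descents_perm[OF u] by force+
  moreover have "inv_descents y \<subseteq> {m<..}"
    by (auto simp: y_def dest!: inv_descents_in_set)
  ultimately have "inv_descents y = {}" using S by fastforce
  then have "y = rev [Suc m..<Suc n]"
    using w by (intro inv_descents_empty_imp) (auto simp: y_def)
  moreover have "w \<in> shuffles u y"
    unfolding u_def y_def by (rule partition_in_shuffles)
  ultimately show "w \<in> ?R"
    using u \<open>inv_descents u \<subseteq> S\<close> by blast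
next
  fix w assume "w \<in> ?R"
  then obtain u where u: "set u = {1..m}" "distinct u" "inv_descents u \<subseteq> S"
    and w: "w \<in> shuffles u (rev [Suc m..<Suc n])"
    by (auto simp: permutations_of_set_def)
  let ?y = "rev [Suc m..<Suc n]"
  have filters: "filter (\<lambda>v. v \<le> m) w = u" "filter (\<lambda>v. \<not> v \<le> m) w = ?y"
    by (rule filter_shuffles_separated[OF _ _ w]; use u in \<open>simp del: upt_Suc\<close>)+
  have "v \<in> insert m S" if v: "v \<in> inv_descents w" for v
  proof -
    \<comment> \<open>Only for \<open>v = m\<close> are \<open>v\<close> and \<open>Suc v\<close> in
      different components; otherwise one filter keeps both.\<close>
    consider "v = m" | "v < m" | "m < v" by linarith
    then show ?thesis
    proof cases
      case 2
      then show ?thesis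
        using inv_descents_filter[OF v, of "\<lambda>v. v \<le> m"] filters u by auto
    next
      case 3
      then have "v \<in> inv_descents ?y"
        using inv_descents_filter[OF v, of "\<lambda>v. \<not> v \<le> m"] unfolding filters by simp
      then show ?thesis unfolding inv_descents_rev_upt by simp
    qed simp
  qed
  moreover have "set w = {1..n}"
    using set_shuffles[OF w] u \<open>m < n\<close> by auto
  moreover have "distinct w"
    by (rule distinct_disjoint_shuffles[OF _ _ _ w]) (use u in \<open>auto simp del: upt_Suc\<close>)
  ultimately show "w \<in> ?L"
    by (auto simp: permutations_of_set_def)
qed

text \<open>Splitting at the largest element \<open>m\<close> of \<open>S\<close> leaves the sum for
  \<open>m\<close> and \<open>S - {m}\<close>, times a q-binomial coefficient, to which
  \<open>qbinom_const_mod\<close> applies.\<close>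

lemma const_mod_inv_descents_subset:
  assumes p: "prime p" and "p dvd n \<or> [n = 1] (mod p)" "S \<subseteq> {1..<n}"
  shows "const_mod p (\<Sum>w | w \<in> permutations_of_set {1..n} \<and> inv_descents w \<subseteq> S. X ^ rev_maj w)"
  using assms(2,3)
proof (induction n arbitrary: S rule: less_induct)
  case (less n)
  show ?case
  proof (cases "S = {}")
    \<comment> \<open>Only the increasing permutation remains, with major index 0.\<close>
    case True
    have "{w. w \<in> permutations_of_set {1..n} \<and> inv_descents w \<subseteq> S} = {rev [1..<Suc n]}"
      using inv_descents_empty_imp[of _ 1 "Suc n"] inv_descents_rev_upt[of 1 "Suc n"] True
      by (auto simp: permutations_of_set_def atLeastLessThanSuc_atLeastAtMost simp del: upt_Suc)
    then show ?thesis
      by (simp add: rev_maj_sorted sorted_rev_upt const_mod_1 del: upt_Suc)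
  next
    case False
    define m where "m = Max S"
    define T where "T = S - {m}"
    have "finite S" using less.prems finite_subset by blast
    then have m: "m \<in> S" "\<And>x. x \<in> S \<Longrightarrow> x \<le> m"
      using False by (auto simp: m_def)
    have S: "S = insert m T" and T: "T \<subseteq> {1..<m}" and mn: "m < n"
      using m less.prems(2) by (fastforce simp: T_def le_neq_implies_less)+
    let ?U = "{u \<in> permutations_of_set {1..m}. inv_descents u \<subseteq> T}"
    let ?y = "rev [Suc m..<Suc n]"
    let ?B = "qbinom X (n - m) m"
    have "(\<Sum>w | w \<in> permutations_of_set {1..n} \<and> inv_descents w \<subseteq> S. X ^ rev_maj w)
        = (\<Sum>u\<in>?U. \<Sum>w\<in>shuffles u ?y. X ^ rev_maj w)"
      unfolding S perms_split[OF T mn]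
    proof (rule sum.UNION_disjoint)
      have "filter (\<lambda>v. v \<le> m) w = u" if "u \<in> ?U" "w \<in> shuffles u ?y" for u w
        by (rule filter_shuffles_separated(1)[OF _ _ that(2)])
          (use that(1) in \<open>simp_all add: permutations_of_set_def del: upt_Suc\<close>)
      then show "\<forall>u\<in>?U. \<forall>u'\<in>?U. u \<noteq> u' \<longrightarrow> shuffles u ?y \<inter> shuffles u' ?y = {}"
        by blast
    qed auto
    also have "\<dots> = (\<Sum>u\<in>?U. X ^ rev_maj u * ?B)"
    proof (rule sum.cong)
      fix u assume "u \<in> ?U"
      then have u: "set u = {1..m}" "length u = m"
        by (auto simp: permutations_of_set_def distinct_card[symmetric])
      then show "(\<Sum>w\<in>shuffles u ?y. X ^ rev_maj w) = X ^ rev_maj u * ?B"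
        using conjunct1[OF sum_shuffles_rev_maj[OF sorted_rev_upt[of "Suc m" "Suc n"], of u X]]
        by (auto simp del: upt_Suc)
    qed simp
    also have "\<dots> = (\<Sum>u\<in>?U. X ^ rev_maj u) * ?B"
      by (simp add: sum_distrib_right)
    finally have eq: "(\<Sum>w | w \<in> permutations_of_set {1..n} \<and> inv_descents w \<subseteq> S. X ^ rev_maj w)
        = (\<Sum>u\<in>?U. X ^ rev_maj u) * ?B" .
    have "p dvd (n - m) + m \<or> [(n - m) + m = 1] (mod p)"
      using less.prems mn by simp
    from qbinom_const_mod[OF p this] show ?thesis
    proof
      assume "[?B = 0] (mod cyc p)"
      then have "[(\<Sum>u\<in>?U. X ^ rev_maj u) * ?B = (\<Sum>u\<in>?U. X ^ rev_maj u) * 0] (mod cyc p)"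
        by (intro cong_mult cong_refl)
      then show ?thesis
        unfolding eq by (rule const_mod_cong) (simp add: const_mod_0)
    next
      assume "(p dvd m \<or> [m = 1] (mod p)) \<and> const_mod p ?B"
      then show ?thesis
        unfolding eq using less.IH[OF mn _ T] const_mod_mult by blast
    qed
  qed
qed

text \<open>Inclusion-exclusion as an induction: from the sum over
  \<open>inv_descents w \<subseteq> S\<close>, subtract the sums for the proper subsets of
  \<open>S\<close>.\<close>

lemma const_mod_inv_descents_eq:
  assumes p: "prime p" and n: "p dvd n \<or> [n = 1] (mod p)" and S: "S \<subseteq> {1..<n}"
  shows "const_mod p (\<Sum>w | w \<in> permutations_of_set {1..n} \<and> inv_descents w = S. X ^ rev_maj w)"
proof -
  have "finite S" using S finite_subset by blast
  then show ?thesis using S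
  proof (induction S rule: finite_psubset_induct)
    case (psubset S)
    let ?W = "permutations_of_set {1..n}"
    let ?f = "\<lambda>T. \<Sum>w | w \<in> ?W \<and> inv_descents w = T. X ^ rev_maj w"
    have "(\<Sum>w | w \<in> ?W \<and> inv_descents w \<subseteq> S. X ^ rev_maj w)
        = (\<Sum>T\<in>Pow S. \<Sum>w | w \<in> {w \<in> ?W. inv_descents w \<subseteq> S} \<and> inv_descents w = T. X ^ rev_maj w)"
      using psubset.hyps by (subst sum.group) auto
    also have "\<dots> = (\<Sum>T\<in>Pow S. ?f T)"
      by (intro sum.cong refl) auto
    also have "\<dots> = ?f S + (\<Sum>T\<in>Pow S - {S}. ?f T)"
      using psubset.hyps by (intro sum.remove) auto
    finally have "?f S = (\<Sum>w | w \<in> ?W \<and> inv_descents w \<subseteq> S. X ^ rev_maj w) - (\<Sum>T\<in>Pow S - {S}. ?f T)"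
      by simp
    also have "const_mod p \<dots>"
      using psubset.prems
      by (intro const_mod_diff const_mod_sum psubset.IH const_mod_inv_descents_subset[OF p n]) auto
    finally show ?case .
  qed
qed

text \<open>The inverse major index depends only on the inverse descent set, so its residue can be
  prescribed through \<open>P\<close>.\<close>

lemma const_mod_inv_descents_Sum:
  assumes p: "prime p" and n: "p dvd n \<or> [n = 1] (mod p)"
  shows "const_mod p (\<Sum>w | w \<in> permutations_of_set {1..n} \<and> P (inv_descents w). X ^ rev_maj w)"
proof -
  let ?W = "permutations_of_set {1..n}"
  have "(\<Sum>w | w \<in> ?W \<and> P (inv_descents w). X ^ rev_maj w)
      = (\<Sum>T | T \<subseteq> {1..<n} \<and> P T. \<Sum>w | w \<in> {w \<in> ?W. P (inv_descents w)} \<and> inv_descents w = T. X ^ rev_maj w)"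
    by (subst sum.group) (use inv_descents_perm in auto)
  also have "\<dots> = (\<Sum>T | T \<subseteq> {1..<n} \<and> P T. \<Sum>w | w \<in> ?W \<and> inv_descents w = T. X ^ rev_maj w)"
    by (intro sum.cong refl) auto
  also have "const_mod p \<dots>"
    by (intro const_mod_sum const_mod_inv_descents_eq[OF p n]) auto
  finally show ?thesis .
qed

subsection \<open>Permutations as words\<close>

text \<open>One-line notation read from right to left, the order that \<open>rev_maj\<close>
  expects.\<close>

definition rev_word :: "nat \<Rightarrow> (nat \<Rightarrow> nat) \<Rightarrow> nat list" where
  "rev_word n \<pi> = map \<pi> (rev [1..<Suc n])"

lemma bij_betw_rev_word: "bij_betw (rev_word n) (sym_group n) (permutations_of_set {1..n})"
proof -
  have inj: "inj_on (rev_word n) (sym_group n)"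
  proof (rule inj_onI)
    fix \<pi> \<sigma> assume *: "\<pi> \<in> sym_group n" "\<sigma> \<in> sym_group n" "rev_word n \<pi> = rev_word n \<sigma>"
    then have "\<pi> x = \<sigma> x" if "x \<in> {1..n}" for x
      using that by (auto simp: rev_word_def simp del: upt_Suc)
    moreover have "\<pi> x = \<sigma> x" if "x \<notin> {1..n}" for x
      using * that by (simp add: sym_group_def permutes_not_in)
    ultimately show "\<pi> = \<sigma>" by blast
  qed
  have sub: "rev_word n ` sym_group n \<subseteq> permutations_of_set {1..n}"
    by (auto simp: sym_group_def permutations_of_set_def rev_word_def distinct_map
        atLeastLessThanSuc_atLeastAtMost permutes_image permutes_inj_on simp del: upt_Suc)
  have "card (rev_word n ` sym_group n) = card (permutations_of_set {1..n})"
    using card_permutations[of "{1..n}" n] unfolding card_image[OF inj] by (simp add: sym_group_def)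
  then have "rev_word n ` sym_group n = permutations_of_set {1..n}"
    using sub by (intro card_subset_eq) auto
  then show ?thesis using inj by (simp add: bij_betw_def)
qed

lemma rev_maj_rev_word: "rev_maj (rev_word n \<pi>) = maj n \<pi>"
proof (induction n)
  case (Suc n)
  have "{i. i \<in> {1..<Suc n} \<and> \<pi> i > \<pi> (i + 1)}
      = {i. i \<in> {1..<n} \<and> \<pi> i > \<pi> (i + 1)} \<union> (if 1 \<le> n \<and> \<pi> n > \<pi> (n + 1) then {n} else {})"
    by (auto simp: less_Suc_eq)
  then have "maj (Suc n) \<pi> = maj n \<pi> + (if 1 \<le> n \<and> \<pi> n > \<pi> (n + 1) then n else 0)"
    unfolding maj_def by (auto simp: sum.union_disjoint)
  then show ?case
    using Suc by (cases n) (auto simp: rev_word_def)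
qed (simp add: rev_word_def maj_def)

lemma subseq_pair_rev_upt: "subseq [x, y] (rev [a..<b]) \<longleftrightarrow> a \<le> y \<and> y < x \<and> x < b"
  by (induction b) (auto simp: subseq_singleton_left)

text \<open>Applying the inverse of \<open>\<pi>\<close> letterwise turns the word into
  \<open>rev [1..<Suc n]\<close>, whose two-letter subsequences are the decreasing pairs.\<close>

lemma inv_descents_rev_word:
  assumes "\<pi> \<in> sym_group n"
  shows "inv_descents (rev_word n \<pi>)
    = {i. i \<in> {1..<n} \<and> Hilbert_Choice.inv \<pi> i > Hilbert_Choice.inv \<pi> (i + 1)}"
proof -
  let ?\<sigma> = "Hilbert_Choice.inv \<pi>"
  have \<pi>: "\<pi> permutes {1..n}" using assms by (simp add: sym_group_def)
  have \<sigma>: "?\<sigma> permutes {1..n}" using \<pi> by (rule permutes_inv)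
  have "subseq [v, Suc v] (rev_word n \<pi>) \<longleftrightarrow> subseq [?\<sigma> v, ?\<sigma> (Suc v)] (rev [1..<Suc n])" for v
  proof
    assume "subseq [v, Suc v] (rev_word n \<pi>)"
    from subseq_map[OF this, of ?\<sigma>] show "subseq [?\<sigma> v, ?\<sigma> (Suc v)] (rev [1..<Suc n])"
      by (simp add: rev_word_def permutes_inverses[OF \<pi>] o_def del: upt_Suc)
  next
    assume "subseq [?\<sigma> v, ?\<sigma> (Suc v)] (rev [1..<Suc n])"
    from subseq_map[OF this, of \<pi>] show "subseq [v, Suc v] (rev_word n \<pi>)"
      by (simp add: rev_word_def permutes_inverses[OF \<pi>] del: upt_Suc)
  qed
  then have iff: "v \<in> inv_descents (rev_word n \<pi>)
      \<longleftrightarrow> ?\<sigma> (Suc v) < ?\<sigma> v \<and> ?\<sigma> v \<in> {1..n} \<and> ?\<sigma> (Suc v) \<in> {1..n}" for v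
    unfolding inv_descents_def mem_Collect_eq subseq_pair_rev_upt atLeastAtMost_iff less_Suc_eq_le
    by (meson less_imp_le order_trans)
  show ?thesis
    unfolding set_eq_iff iff permutes_in_image[OF \<sigma>] by auto
qed

lemma sum_inv_descents_rev_word:
  "\<pi> \<in> sym_group n \<Longrightarrow> \<Sum>(inv_descents (rev_word n \<pi>)) = maj n (Hilbert_Choice.inv \<pi>)"
  by (simp add: inv_descents_rev_word maj_def)

text \<open>The condition modulo \<open>l\<close> sits in an inner set, to serve as \<open>W\<close>
  in \<open>const_mod_imp_card_eq\<close>.\<close>

lemma maj_count_eq_card:
  "maj_count n k l i j = card {w \<in> {w \<in> permutations_of_set {1..n}. [\<Sum>(inv_descents w) = j] (mod l)}.
     [rev_maj w = i] (mod k)}"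
proof -
  have "bij_betw (rev_word n)
    {\<pi> \<in> sym_group n. [maj n \<pi> = i] (mod k) \<and> [maj n (Hilbert_Choice.inv \<pi>) = j] (mod l)}
    {w \<in> permutations_of_set {1..n}. [rev_maj w = i] (mod k) \<and> [\<Sum>(inv_descents w) = j] (mod l)}"
    using bij_betw_rev_word
    by (rule bij_betw_Collect) (auto simp: rev_maj_rev_word sum_inv_descents_rev_word)
  from bij_betw_same_card[OF this] show ?thesis
    unfolding maj_count_def by (simp add: conj_ac)
qed

lemma maj_count_row:
  assumes "prime p" "p dvd n \<or> [n = 1] (mod p)" "i \<in> {0<..<p}" "i' \<in> {0<..<p}"
  shows "maj_count n p p i j = maj_count n p p i' j"
  unfolding maj_count_eq_card
  by (rule const_mod_imp_card_eq)
    (use assms const_mod_inv_descents_Sum[of p n "\<lambda>S. [\<Sum>S = j] (mod p)"] in auto)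

text \<open>Inversion exchanges the two conditions; this carries \<open>maj_count_row\<close> over
  to columns.\<close>

lemma maj_count_commute: "maj_count n k l i j = maj_count n l k j i"
proof -
  have "bij_betw Hilbert_Choice.inv
    {\<pi> \<in> sym_group n. [maj n \<pi> = i] (mod k) \<and> [maj n (Hilbert_Choice.inv \<pi>) = j] (mod l)}
    {\<pi> \<in> sym_group n. [maj n \<pi> = j] (mod l) \<and> [maj n (Hilbert_Choice.inv \<pi>) = i] (mod k)}"
    by (rule bij_betw_byWitness[where f' = Hilbert_Choice.inv])
      (auto simp: sym_group_def permutes_inv permutes_inv_inv)
  from bij_betw_same_card[OF this] show ?thesis
    unfolding maj_count_def .
qed

lemma maj_mat_block:
  assumes p: "prime p" and n: "p dvd n \<or> [n = 1] (mod p)"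
  shows "maj_mat n p p = four_block_mat
    (maj_count n p p 0 0 \<cdot>\<^sub>m ones_mat 1 1)       (maj_count n p p 0 1 \<cdot>\<^sub>m ones_mat 1 (p - 1))
    (maj_count n p p 0 1 \<cdot>\<^sub>m ones_mat (p - 1) 1) (maj_count n p p 1 1 \<cdot>\<^sub>m ones_mat (p - 1) (p - 1))"
proof -
  have p1: "1 \<in> {0<..<p}" using prime_gt_1_nat[OF p] by simp
  have row: "maj_count n p p i j = maj_count n p p 1 j" if "0 < i" "i < p" for i j
    by (rule maj_count_row[OF p n _ p1]) (use that in simp)
  have col: "maj_count n p p i j = maj_count n p p i 1" if "0 < j" "j < p" for i j
    using row[OF that, of i] by (simp only: maj_count_commute[of n p p i])
  show ?thesis
  proof (rule eq_matI, goal_cases)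
    case (1 i j)
    \<comment> \<open>Interior entries reduce to position (1,1). The first column reduces to (1,0),
      which symmetry identifies with (0,1).\<close>
    then show ?case
      using p1 row[of i j] col[of j i] col[of j 1] maj_count_commute[of n p p 1 0]
      by (cases "i = 0"; cases "j = 0") (auto simp: maj_mat_def ones_mat_def)
  qed (use p1 in \<open>auto simp: maj_mat_def ones_mat_def\<close>)
qed

theorem theorem5p2:
  fixes p :: nat
  assumes "prime p"
  shows "(\<exists>q r s :: nat \<Rightarrow> nat. \<forall>n\<ge>1.
            maj_mat (n * p) p p =
              four_block_mat
                (q n \<cdot>\<^sub>m ones_mat 1 1)       (r n \<cdot>\<^sub>m ones_mat 1 (p - 1))
                (r n \<cdot>\<^sub>m ones_mat (p - 1) 1) (s n \<cdot>\<^sub>m ones_mat (p - 1) (p - 1)))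
       \<and> (\<exists>q r s :: nat \<Rightarrow> nat. \<forall>n\<ge>1.
            maj_mat (n * p + 1) p p =
              four_block_mat
                (q n \<cdot>\<^sub>m ones_mat 1 1)       (r n \<cdot>\<^sub>m ones_mat 1 (p - 1))
                (r n \<cdot>\<^sub>m ones_mat (p - 1) 1) (s n \<cdot>\<^sub>m ones_mat (p - 1) (p - 1)))"
proof (intro conjI exI allI impI)
  fix n :: nat
  have "p dvd n * p" "[n * p + 1 = 1] (mod p)"
    unfolding cong_add_rcancel_0_nat by (simp_all add: cong_mult_self_right)
  \<comment> \<open>The sequences, left schematic by \<open>exI\<close>, are chosen here by
    unification as the counts at (0,0), (0,1) and (1,1).\<close>
  then show "maj_mat (n * p) p p = four_block_mat
      (maj_count (n * p) p p 0 0 \<cdot>\<^sub>m ones_mat 1 1) (maj_count (n * p) p p 0 1 \<cdot>\<^sub>m ones_mat 1 (p - 1))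
      (maj_count (n * p) p p 0 1 \<cdot>\<^sub>m ones_mat (p - 1) 1) (maj_count (n * p) p p 1 1 \<cdot>\<^sub>m ones_mat (p - 1) (p - 1))"
    and "maj_mat (n * p + 1) p p = four_block_mat
      (maj_count (n * p + 1) p p 0 0 \<cdot>\<^sub>m ones_mat 1 1) (maj_count (n * p + 1) p p 0 1 \<cdot>\<^sub>m ones_mat 1 (p - 1))
      (maj_count (n * p + 1) p p 0 1 \<cdot>\<^sub>m ones_mat (p - 1) 1) (maj_count (n * p + 1) p p 1 1 \<cdot>\<^sub>m ones_mat (p - 1) (p - 1))"
    using maj_mat_block[OF assms] by blast+
qed

end
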